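(* Let $\mathbb K$ be an algebraically closed field of characteristic $0$ and let $L$ be a Lie-Yamaguti algebra over $\mathbb K$. Let $(F_t,G_t)$ be a one-parameter formal deformation of $L$, with $F_t=\sum_{i\ge 0}F_it^i$, $G_t=\sum_{i\ge 0}G_it^i$, let $n\ge 1$, and suppose that $(F_n,G_n)$ is the $n$-infinitesimal of this deformation. Then $(F_n,G_n)$ is a $(2,3)$-cocycle, i.e. $(F_n,G_n)\in Z^{(2,3)}(L;L)$.
   Context: A Lie-Yamaguti algebra $(L,[\,,],\{\,,,\})$ over a commutative ring $k$ is a $k$-module $L$ with a $k$-bilinear map $[\,,]:L\times L\to L$ and a $k$-trilinear map $\{\,,,\}:L\times L\times L\to L$ such that for all $x,y,z,u,v,w\in L$ (with $\sum_{\circlearrowleft(x,y,z)}$ the sum over cyclic permutations of $x,y,z$): (LY1) $[x,y]=-[y,x]$; (LY2) $\{x,y,z\}=-\{y,x,z\}$; (LY3) $\sum_{\circlearrowleft(x,y,z)}([[x,y],z]+\{x,y,z\})=0$; (LY4) $\sum_{\circlearrowleft(x,y,z)}\{[x,y],z,u\}=0$; (LY5) $\{x,y,[u,v]\}=[\{x,y,u\},v]+[u,\{x,y,v\}]$; (LY6) $\{x,y,\{u,v,w\}\}=\{\{x,y,u\},v,w\}+\{u,\{x,y,v\},w\}+\{u,v,\{x,y,w\}\}$. Deformations. Let $K=\mathbb K[[t]]$ and let $L[[t]]$ be the $K$-module of formal power series in $t$ with coefficients in $L$. Multilinear maps on $L$ over $\mathbb K$ are extended to $L[[t]]$ $K$-multilinearly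 (by the usual formula on power series). A one-parameter formal deformation of $L$ is a pair $(F_t,G_t)$ with $F_t=\sum_{i\ge0}F_it^i$ and $G_t=\sum_{i\ge0}G_it^i$, where each $F_i:L\times L\to L$ is $\mathbb K$-bilinear, each $G_i:L\times L\times L\to L$ is $\mathbb K$-trilinear, $F_0=[\,,]$, $G_0=\{\,,,\}$, such that $(L[[t]],F_t,G_t)$ is a Lie-Yamaguti algebra over $K$. If $F_i=0=G_i$ for $1\le i\le n-1$ and $(F_n,G_n)\neq(0,0)$, then $(F_n,G_n)$ is called the $n$-infinitesimal of the deformation. Cochains and cocycles (adjoint coefficients). $C^{(2,3)}(L;L)$ is the space of pairs $(f,g)$ with $f:L^2\to L$ bilinear, $f(x,x)=0$, and $g:L^3\to L$ trilinear, $g(x,x,y)=0$. For $(f,g)\in C^{(2,3)}(L;L)$ put $\delta(f,g)=(\delta_If,\delta_{II}g)$, $\delta^*(f,g)=(\delta^*_If,\delta^*_{II}g)$, where (each component may depend on both $f$ and $g$) $\delta_If(a,b,c,d)=-[c,g(a,b,d)]+[d,g(a,b,c)]+g(a,b,[c,d])+\{a,b,f(c,d)\}-f(\{a,b,c\},d)-f(c,\{a,b,d\})$; $\delta_{II}g(a,b,c,d,e)=-\{g(a,b,c),d,e\}+\{g(a,b,d),c,e\}+\{a,b,g(c,d,e)\}-\{c,d,g(a,b,e)\}-g(\{a,b,c\},d,e)-g(c,\{a,b,d\},e)-g(c,d,\{a,b,e\})+g(a,b,\{c,d,e\})$; $\delta^*_If(a,b,c)=-[a,f(b,c)]-[b,f(c,a)]-[c,f(a,b)]+f([a,b],c)+f([b,c],a)+f([c,a],b)+g(a,b,c)+g(b,c,a)+g(c,a,b)$;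 $\delta^*_{II}g(a,b,c,d)=\{f(b,c),a,d\}+\{f(c,a),b,d\}+\{f(a,b),c,d\}+g([a,b],c,d)+g([b,c],a,d)+g([c,a],b,d)$. $Z^{(2,3)}(L;L)=\{(f,g)\in C^{(2,3)}(L;L):\delta(f,g)=0,\ \delta^*(f,g)=0\}$; its elements are called $(2,3)$-cocycles. *)

theory Defs
  imports "HOL-Computational_Algebra.Computational_Algebra"
begin

definition bilinear_map ::
  "('k::comm_ring_1 \<Rightarrow> 'l::ab_group_add \<Rightarrow> 'l) \<Rightarrow> ('l \<Rightarrow> 'l \<Rightarrow> 'l) \<Rightarrow> bool" where
  "bilinear_map scale f \<longleftrightarrow>
     (\<forall>y. module_hom scale scale (\<lambda>x. f x y)) \<and>
     (\<forall>x. module_hom scale scale (\<lambda>y. f x y))"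

definition trilinear_map ::
  "('k::comm_ring_1 \<Rightarrow> 'l::ab_group_add \<Rightarrow> 'l) \<Rightarrow> ('l \<Rightarrow> 'l \<Rightarrow> 'l \<Rightarrow> 'l) \<Rightarrow> bool" where
  "trilinear_map scale g \<longleftrightarrow>
     (\<forall>y z. module_hom scale scale (\<lambda>x. g x y z)) \<and>
     (\<forall>x z. module_hom scale scale (\<lambda>y. g x y z)) \<and>
     (\<forall>x y. module_hom scale scale (\<lambda>z. g x y z))"

definition cyclic_sum :: "('l \<Rightarrow> 'l \<Rightarrow> 'l \<Rightarrow> 'l::ab_group_add) \<Rightarrow> 'l \<Rightarrow> 'l \<Rightarrow> 'l \<Rightarrow> 'l" where
  "cyclic_sum h x y z = h x y z + h y z x + h z x y"

locale lie_yamaguti_algebra = module scale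
  for scale :: "'k::comm_ring_1 \<Rightarrow> 'l::ab_group_add \<Rightarrow> 'l" +
  fixes br :: "'l \<Rightarrow> 'l \<Rightarrow> 'l"
    and tr :: "'l \<Rightarrow> 'l \<Rightarrow> 'l \<Rightarrow> 'l"
  assumes bilinear_br: "bilinear_map scale br"
    and trilinear_tr: "trilinear_map scale tr"
    and LY1: "br x y = - br y x"
    and LY2: "tr x y z = - tr y x z"
    and LY3: "cyclic_sum (\<lambda>x y z. br (br x y) z + tr x y z) x y z = 0"
    and LY4: "cyclic_sum (\<lambda>x y z. tr (br x y) z u) x y z = 0"
    and LY5: "tr x y (br u v) = br (tr x y u) v + br u (tr x y v)"
    and LY6: "tr x y (tr u v w) = tr (tr x y u) v w + tr u (tr x y v) w + tr u v (tr x y w)"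


text \<open>
  The module \<open>L[[t]]\<close> over \<open>k[[t]]\<close> is modelled by the type \<open>'l fps\<close>, which is an abelian group
  whenever \<open>'l\<close> is one; it carries the scalar multiplication below.
\<close>

definition fps_scale ::
  "('k::comm_ring_1 \<Rightarrow> 'l::ab_group_add \<Rightarrow> 'l) \<Rightarrow> 'k fps \<Rightarrow> 'l fps \<Rightarrow> 'l fps" where
  "fps_scale scale c x = Abs_fps (\<lambda>n. \<Sum>i\<le>n. scale (fps_nth c i) (fps_nth x (n - i)))"

text \<open>The \<open>k[[t]]\<close>-multilinear extensions to \<open>L[[t]]\<close> of multilinear maps on \<open>L\<close>.\<close>

definition fps_ext2 ::
  "('l::ab_group_add \<Rightarrow> 'l \<Rightarrow> 'l) \<Rightarrow> 'l fps \<Rightarrow> 'l fps \<Rightarrow> 'l fps" where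
  "fps_ext2 f x y =
     Abs_fps (\<lambda>n. \<Sum>(i, j) \<in> {(i, j). i + j = n}. f (fps_nth x i) (fps_nth y j))"

definition fps_ext3 ::
  "('l::ab_group_add \<Rightarrow> 'l \<Rightarrow> 'l \<Rightarrow> 'l) \<Rightarrow> 'l fps \<Rightarrow> 'l fps \<Rightarrow> 'l fps \<Rightarrow> 'l fps" where
  "fps_ext3 g x y z =
     Abs_fps (\<lambda>n. \<Sum>(i, j, k) \<in> {(i, j, k). i + j + k = n}.
                    g (fps_nth x i) (fps_nth y j) (fps_nth z k))"

text \<open>
  The operations \<open>F\<^sub>t = \<Sum>\<^sub>i F\<^sub>i t\<^sup>i\<close> and \<open>G\<^sub>t = \<Sum>\<^sub>i G\<^sub>i t\<^sup>i\<close> on \<open>L[[t]]\<close>: multiplication by \<open>t\<^sup>i\<close> shifts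
  coefficients by \<open>i\<close>, so only the terms with \<open>i \<le> n\<close> contribute to the coefficient of \<open>t\<^sup>n\<close>.
\<close>

definition deformed_br ::
  "(nat \<Rightarrow> 'l::ab_group_add \<Rightarrow> 'l \<Rightarrow> 'l) \<Rightarrow> 'l fps \<Rightarrow> 'l fps \<Rightarrow> 'l fps" where
  "deformed_br F x y = Abs_fps (\<lambda>n. \<Sum>i\<le>n. fps_nth (fps_ext2 (F i) x y) (n - i))"

definition deformed_tr ::
  "(nat \<Rightarrow> 'l::ab_group_add \<Rightarrow> 'l \<Rightarrow> 'l \<Rightarrow> 'l) \<Rightarrow> 'l fps \<Rightarrow> 'l fps \<Rightarrow> 'l fps \<Rightarrow> 'l fps" where
  "deformed_tr G x y z = Abs_fps (\<lambda>n. \<Sum>i\<le>n. fps_nth (fps_ext3 (G i) x y z) (n - i))"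

definition formal_deformation ::
  "('k::comm_ring_1 \<Rightarrow> 'l::ab_group_add \<Rightarrow> 'l) \<Rightarrow> ('l \<Rightarrow> 'l \<Rightarrow> 'l) \<Rightarrow> ('l \<Rightarrow> 'l \<Rightarrow> 'l \<Rightarrow> 'l) \<Rightarrow>
   (nat \<Rightarrow> 'l \<Rightarrow> 'l \<Rightarrow> 'l) \<Rightarrow> (nat \<Rightarrow> 'l \<Rightarrow> 'l \<Rightarrow> 'l \<Rightarrow> 'l) \<Rightarrow> bool" where
  "formal_deformation scale br tr F G \<longleftrightarrow>
     (\<forall>i. bilinear_map scale (F i)) \<and> (\<forall>i. trilinear_map scale (G i)) \<and>
     F 0 = br \<and> G 0 = tr \<and>
     lie_yamaguti_algebra (fps_scale scale) (deformed_br F) (deformed_tr G)"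

definition has_infinitesimal ::
  "nat \<Rightarrow> (nat \<Rightarrow> 'l::ab_group_add \<Rightarrow> 'l \<Rightarrow> 'l) \<Rightarrow> (nat \<Rightarrow> 'l \<Rightarrow> 'l \<Rightarrow> 'l \<Rightarrow> 'l) \<Rightarrow> bool" where
  "has_infinitesimal n F G \<longleftrightarrow>
     (\<forall>i. 1 \<le> i \<and> i < n \<longrightarrow> F i = (\<lambda>_ _. 0) \<and> G i = (\<lambda>_ _ _. 0)) \<and>
     (F n, G n) \<noteq> ((\<lambda>_ _. 0), (\<lambda>_ _ _. 0))"

definition cochains23 ::
  "('k::comm_ring_1 \<Rightarrow> 'l::ab_group_add \<Rightarrow> 'l) \<Rightarrow>
   (('l \<Rightarrow> 'l \<Rightarrow> 'l) \<times> ('l \<Rightarrow> 'l \<Rightarrow> 'l \<Rightarrow> 'l)) set" where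
  "cochains23 scale =
     {(f, g). bilinear_map scale f \<and> (\<forall>x. f x x = 0) \<and>
              trilinear_map scale g \<and> (\<forall>x y. g x x y = 0)}"

definition delta_I ::
  "('l::ab_group_add \<Rightarrow> 'l \<Rightarrow> 'l) \<Rightarrow> ('l \<Rightarrow> 'l \<Rightarrow> 'l \<Rightarrow> 'l) \<Rightarrow>
   ('l \<Rightarrow> 'l \<Rightarrow> 'l) \<times> ('l \<Rightarrow> 'l \<Rightarrow> 'l \<Rightarrow> 'l) \<Rightarrow> 'l \<Rightarrow> 'l \<Rightarrow> 'l \<Rightarrow> 'l \<Rightarrow> 'l" where
  "delta_I br tr = (\<lambda>(f, g) a b c d.
     - br c (g a b d) + br d (g a b c) + g a b (br c d)
     + tr a b (f c d) - f (tr a b c) d - f c (tr a b d))"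

definition delta_II ::
  "('l::ab_group_add \<Rightarrow> 'l \<Rightarrow> 'l) \<Rightarrow> ('l \<Rightarrow> 'l \<Rightarrow> 'l \<Rightarrow> 'l) \<Rightarrow>
   ('l \<Rightarrow> 'l \<Rightarrow> 'l) \<times> ('l \<Rightarrow> 'l \<Rightarrow> 'l \<Rightarrow> 'l) \<Rightarrow> 'l \<Rightarrow> 'l \<Rightarrow> 'l \<Rightarrow> 'l \<Rightarrow> 'l \<Rightarrow> 'l" where
  "delta_II br tr = (\<lambda>(f, g) a b c d e.
     - tr (g a b c) d e + tr (g a b d) c e + tr a b (g c d e) - tr c d (g a b e)
     - g (tr a b c) d e - g c (tr a b d) e - g c d (tr a b e) + g a b (tr c d e))"

definition delta_star_I ::
  "('l::ab_group_add \<Rightarrow> 'l \<Rightarrow> 'l) \<Rightarrow> ('l \<Rightarrow> 'l \<Rightarrow> 'l \<Rightarrow> 'l) \<Rightarrow>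
   ('l \<Rightarrow> 'l \<Rightarrow> 'l) \<times> ('l \<Rightarrow> 'l \<Rightarrow> 'l \<Rightarrow> 'l) \<Rightarrow> 'l \<Rightarrow> 'l \<Rightarrow> 'l \<Rightarrow> 'l" where
  "delta_star_I br tr = (\<lambda>(f, g) a b c.
     - br a (f b c) - br b (f c a) - br c (f a b)
     + f (br a b) c + f (br b c) a + f (br c a) b
     + g a b c + g b c a + g c a b)"

definition delta_star_II ::
  "('l::ab_group_add \<Rightarrow> 'l \<Rightarrow> 'l) \<Rightarrow> ('l \<Rightarrow> 'l \<Rightarrow> 'l \<Rightarrow> 'l) \<Rightarrow>
   ('l \<Rightarrow> 'l \<Rightarrow> 'l) \<times> ('l \<Rightarrow> 'l \<Rightarrow> 'l \<Rightarrow> 'l) \<Rightarrow> 'l \<Rightarrow> 'l \<Rightarrow> 'l \<Rightarrow> 'l \<Rightarrow> 'l" where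
  "delta_star_II br tr = (\<lambda>(f, g) a b c d.
     tr (f b c) a d + tr (f c a) b d + tr (f a b) c d
     + g (br a b) c d + g (br b c) a d + g (br c a) b d)"

definition cocycles23 ::
  "('k::comm_ring_1 \<Rightarrow> 'l::ab_group_add \<Rightarrow> 'l) \<Rightarrow> ('l \<Rightarrow> 'l \<Rightarrow> 'l) \<Rightarrow> ('l \<Rightarrow> 'l \<Rightarrow> 'l \<Rightarrow> 'l) \<Rightarrow>
   (('l \<Rightarrow> 'l \<Rightarrow> 'l) \<times> ('l \<Rightarrow> 'l \<Rightarrow> 'l \<Rightarrow> 'l)) set" where
  "cocycles23 scale br tr =
     {h \<in> cochains23 scale.
        (delta_I br tr h, delta_II br tr h) = ((\<lambda>_ _ _ _. 0), (\<lambda>_ _ _ _ _. 0)) \<and>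
        (delta_star_I br tr h, delta_star_II br tr h) = ((\<lambda>_ _ _. 0), (\<lambda>_ _ _ _. 0))}"

end

theory Submission
  imports Defs
begin

text \<open>
  The \<open>n\<close>-infinitesimal is the first-order term of the deformation in the parameter
  \<open>s = t\<^sup>n\<close>. Call a power series gapped if its coefficients in the degrees strictly between
  \<open>0\<close> and \<open>n\<close> vanish. As \<open>F\<^sub>i\<close> and \<open>G\<^sub>i\<close> vanish for these \<open>i\<close>, the deformed operations
  preserve gapped series, and modulo \<open>t\<^bsup>n+1\<^esup>\<close> a gapped series \<open>x\<^sub>0 + x\<^sub>n t\<^sup>n\<close> behaves like the
  element \<open>x\<^sub>0 + x\<^sub>n s\<close> over the dual numbers \<open>s\<^sup>2 = 0\<close>: the coefficient of \<open>t\<^sup>n\<close> in a product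
  obeys the Leibniz rule, with one more term in which the operation itself contributes \<open>F\<^sub>n\<close>
  or \<open>G\<^sub>n\<close> (lemmas \<open>deformed_br_nth_gap\<close> and \<open>deformed_tr_nth_gap\<close>).

  Comparing the coefficients of \<open>t\<^sup>n\<close> in the six axioms for \<open>L[[t]]\<close>, evaluated at constant
  series, therefore linearises the axioms at \<open>([,], {,,})\<close> in the direction \<open>(F\<^sub>n, G\<^sub>n)\<close>. The
  first two axioms are linear, so they say that \<open>F\<^sub>n\<close> and \<open>G\<^sub>n\<close> are skew in their first two
  arguments, which is the cochain condition because \<open>2\<close> is invertible. The other four become,
  in order, \<open>\<delta>\<^sup>*\<^sub>I = 0\<close>, \<open>\<delta>\<^sup>*\<^sub>I\<^sub>I = 0\<close>, \<open>\<delta>\<^sub>I = 0\<close> and \<open>\<delta>\<^sub>I\<^sub>I = 0\<close>, after skew-symmetry of the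
  undeformed operations has moved some arguments.
\<close>

section \<open>Gapped power series and extended operations\<close>

definition gapped :: "nat \<Rightarrow> 'a::zero fps \<Rightarrow> bool" where
  "gapped n X \<longleftrightarrow> (\<forall>i. 0 < i \<and> i < n \<longrightarrow> fps_nth X i = 0)"

lemma gappedD: "gapped n X \<Longrightarrow> 0 < i \<Longrightarrow> i < n \<Longrightarrow> fps_nth X i = 0"
  by (simp add: gapped_def)

lemma gapped_fps_const: "gapped n (fps_const a)"
  by (simp add: gapped_def)

lemma sum_atMost_ends:
  fixes h :: "nat \<Rightarrow> 'a::comm_monoid_add"
  assumes "0 < n" and "\<And>i. 0 < i \<Longrightarrow> i < n \<Longrightarrow> h i = 0"
  shows "(\<Sum>i\<le>n. h i) = h 0 + h n"
proof -
  have "(\<Sum>i\<le>n. h i) = (\<Sum>i\<in>{0, n}. h i)"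
    by (rule sum.mono_neutral_right) (use assms in auto)
  then show ?thesis
    using assms(1) by simp
qed

lemma finite_sum2_eq: "finite {(i, j). i + j = (n::nat)}"
  by (rule finite_subset[of _ "{..n} \<times> {..n}"]) auto

lemma finite_sum3_eq: "finite {(i, j, k). i + j + k = (n::nat)}"
  by (rule finite_subset[of _ "{..n} \<times> {..n} \<times> {..n}"]) auto

lemma fps_ext2_nth_0: "fps_nth (fps_ext2 f X Y) 0 = f (fps_nth X 0) (fps_nth Y 0)"
proof -
  have "{(i, j). i + j = (0::nat)} = {(0, 0)}"
    by auto
  then show ?thesis
    by (simp add: fps_ext2_def)
qed

lemma fps_ext3_nth_0:
  "fps_nth (fps_ext3 g X Y Z) 0 = g (fps_nth X 0) (fps_nth Y 0) (fps_nth Z 0)"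
proof -
  have "{(i, j, k). i + j + k = (0::nat)} = {(0, 0, 0)}"
    by auto
  then show ?thesis
    by (simp add: fps_ext3_def)
qed

lemma gapped_fps_ext2:
  assumes f: "\<And>x. f x 0 = 0" "\<And>x. f 0 x = 0" and X: "gapped n X" and Y: "gapped n Y"
  shows "gapped n (fps_ext2 f X Y)"
  unfolding gapped_def fps_ext2_def fps_nth_Abs_fps
proof (intro allI impI sum.neutral ballI)
  fix m p
  assume m: "0 < m \<and> m < n" and "p \<in> {(i, j). i + j = m}"
  then obtain i j where p: "p = (i, j)" "i + j = m"
    by auto
  with m have "(0 < i \<and> i < n) \<or> (0 < j \<and> j < n)"
    by linarith
  then show "(case p of (i, j) \<Rightarrow> f (fps_nth X i) (fps_nth Y j)) = 0"
    using gappedD[OF X] gappedD[OF Y] f p by auto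
qed

lemma gapped_fps_ext3:
  assumes g: "\<And>x y. g x y 0 = 0" "\<And>x y. g x 0 y = 0" "\<And>x y. g 0 x y = 0"
    and X: "gapped n X" and Y: "gapped n Y" and Z: "gapped n Z"
  shows "gapped n (fps_ext3 g X Y Z)"
  unfolding gapped_def fps_ext3_def fps_nth_Abs_fps
proof (intro allI impI sum.neutral ballI)
  fix m p
  assume m: "0 < m \<and> m < n" and "p \<in> {(i, j, k). i + j + k = m}"
  then obtain i j k where p: "p = (i, j, k)" "i + j + k = m"
    by auto
  with m have "(0 < i \<and> i < n) \<or> (0 < j \<and> j < n) \<or> (0 < k \<and> k < n)"
    by linarith
  then show "(case p of (i, j, k) \<Rightarrow> g (fps_nth X i) (fps_nth Y j) (fps_nth Z k)) = 0"
    using gappedD[OF X] gappedD[OF Y] gappedD[OF Z] g p by auto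
qed

text \<open>
  In degree \<open>n\<close>, a term of the convolution survives only if every index is \<open>0\<close> or \<open>n\<close>, so
  exactly one index is \<open>n\<close>: this is the Leibniz rule.
\<close>

lemma fps_ext2_nth_gap:
  assumes n: "0 < n" and f: "\<And>x. f x 0 = 0" "\<And>x. f 0 x = 0"
    and X: "gapped n X" and Y: "gapped n Y"
  shows "fps_nth (fps_ext2 f X Y) n
    = f (fps_nth X n) (fps_nth Y 0) + f (fps_nth X 0) (fps_nth Y n)"
proof -
  let ?h = "\<lambda>(i, j). f (fps_nth X i) (fps_nth Y j)"
  have "fps_nth (fps_ext2 f X Y) n = (\<Sum>p\<in>{(i, j). i + j = n}. ?h p)"
    by (simp add: fps_ext2_def)
  also have "\<dots> = (\<Sum>p\<in>{(n, 0), (0, n)}. ?h p)"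
  proof (rule sum.mono_neutral_right)
    show "\<forall>p\<in>{(i, j). i + j = n} - {(n, 0), (0, n)}. ?h p = 0"
    proof
      fix p assume mem: "p \<in> {(i, j). i + j = n} - {(n, 0), (0, n)}"
      obtain i j where p: "p = (i, j)"
        by (cases p)
      have "0 < i \<and> i < n"
        using mem unfolding p by (cases "i = 0"; cases "j = 0") auto
      then show "?h p = 0"
        using gappedD[OF X] f p by auto
    qed
  qed (auto simp: finite_sum2_eq)
  finally show ?thesis
    using n by simp
qed

lemma fps_ext3_nth_gap:
  assumes n: "0 < n"
    and g: "\<And>x y. g x y 0 = 0" "\<And>x y. g x 0 y = 0" "\<And>x y. g 0 x y = 0"
    and X: "gapped n X" and Y: "gapped n Y" and Z: "gapped n Z"
  shows "fps_nth (fps_ext3 g X Y Z) n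
    = g (fps_nth X n) (fps_nth Y 0) (fps_nth Z 0)
    + g (fps_nth X 0) (fps_nth Y n) (fps_nth Z 0)
    + g (fps_nth X 0) (fps_nth Y 0) (fps_nth Z n)"
proof -
  let ?h = "\<lambda>(i, j, k). g (fps_nth X i) (fps_nth Y j) (fps_nth Z k)"
  have "fps_nth (fps_ext3 g X Y Z) n = (\<Sum>p\<in>{(i, j, k). i + j + k = n}. ?h p)"
    by (simp add: fps_ext3_def)
  also have "\<dots> = (\<Sum>p\<in>{(n, 0, 0), (0, n, 0), (0, 0, n)}. ?h p)"
  proof (rule sum.mono_neutral_right)
    show "\<forall>p\<in>{(i, j, k). i + j + k = n} - {(n, 0, 0), (0, n, 0), (0, 0, n)}. ?h p = 0"
    proof
      fix p assume mem: "p \<in> {(i, j, k). i + j + k = n} - {(n, 0, 0), (0, n, 0), (0, 0, n)}"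
      obtain i j k where p: "p = (i, j, k)"
        by (cases p)
      have "(0 < i \<and> i < n) \<or> (0 < j \<and> j < n)"
        using mem unfolding p by (cases "i = 0"; cases "j = 0") auto
      then show "?h p = 0"
        using gappedD[OF X] gappedD[OF Y] g p by auto
    qed
  qed (auto simp: finite_sum3_eq)
  finally show ?thesis
    using n by (simp add: add.assoc)
qed

section \<open>Deformed operations on gapped power series\<close>

text \<open>
  Multilinear operations vanish when an argument does; this is what removes every term in which
  some index lies strictly between \<open>0\<close> and \<open>n\<close>.
\<close>

locale gapped_operations =
  fixes n :: nat
    and F :: "nat \<Rightarrow> 'l::ab_group_add \<Rightarrow> 'l \<Rightarrow> 'l"
    and G :: "nat \<Rightarrow> 'l \<Rightarrow> 'l \<Rightarrow> 'l \<Rightarrow> 'l"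
  assumes n_pos: "0 < n"
    and F_zero [simp]: "F i x 0 = 0" "F i 0 x = 0"
    and G_zero [simp]: "G i x y 0 = 0" "G i x 0 y = 0" "G i 0 x y = 0"
    and F_gap: "0 < i \<Longrightarrow> i < n \<Longrightarrow> F i x y = 0"
    and G_gap: "0 < i \<Longrightarrow> i < n \<Longrightarrow> G i x y z = 0"
begin

lemma deformed_br_nth_0: "fps_nth (deformed_br F X Y) 0 = F 0 (fps_nth X 0) (fps_nth Y 0)"
  by (simp add: deformed_br_def fps_ext2_nth_0)

lemma deformed_tr_nth_0:
  "fps_nth (deformed_tr G X Y Z) 0 = G 0 (fps_nth X 0) (fps_nth Y 0) (fps_nth Z 0)"
  by (simp add: deformed_tr_def fps_ext3_nth_0)

lemma fps_ext2_gap: "0 < i \<Longrightarrow> i < n \<Longrightarrow> fps_nth (fps_ext2 (F i) X Y) m = 0"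
  by (simp add: fps_ext2_def F_gap)

lemma fps_ext3_gap: "0 < i \<Longrightarrow> i < n \<Longrightarrow> fps_nth (fps_ext3 (G i) X Y Z) m = 0"
  by (simp add: fps_ext3_def G_gap)

lemma gapped_deformed_br:
  assumes "gapped n X" "gapped n Y"
  shows "gapped n (deformed_br F X Y)"
  unfolding gapped_def deformed_br_def fps_nth_Abs_fps
proof (intro allI impI sum.neutral ballI)
  fix m i assume m: "0 < m \<and> m < n" and i: "i \<in> {..m}"
  have "gapped n (fps_ext2 (F 0) X Y)"
    by (rule gapped_fps_ext2) (use assms in auto)
  then show "fps_nth (fps_ext2 (F i) X Y) (m - i) = 0"
    using m i by (cases "i = 0") (auto simp: gapped_def fps_ext2_gap)
qed

lemma gapped_deformed_tr:
  assumes "gapped n X" "gapped n Y" "gapped n Z"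
  shows "gapped n (deformed_tr G X Y Z)"
  unfolding gapped_def deformed_tr_def fps_nth_Abs_fps
proof (intro allI impI sum.neutral ballI)
  fix m i assume m: "0 < m \<and> m < n" and i: "i \<in> {..m}"
  have "gapped n (fps_ext3 (G 0) X Y Z)"
    by (rule gapped_fps_ext3) (use assms in auto)
  then show "fps_nth (fps_ext3 (G i) X Y Z) (m - i) = 0"
    using m i by (cases "i = 0") (auto simp: gapped_def fps_ext3_gap)
qed

lemma deformed_br_nth_gap:
  assumes "gapped n X" "gapped n Y"
  shows "fps_nth (deformed_br F X Y) n
    = F 0 (fps_nth X n) (fps_nth Y 0) + F 0 (fps_nth X 0) (fps_nth Y n)
    + F n (fps_nth X 0) (fps_nth Y 0)"
proof -
  have "fps_nth (deformed_br F X Y) n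
      = fps_nth (fps_ext2 (F 0) X Y) n + fps_nth (fps_ext2 (F n) X Y) 0"
    using n_pos by (simp add: deformed_br_def sum_atMost_ends fps_ext2_gap)
  then show ?thesis
    using assms n_pos by (simp add: fps_ext2_nth_0 fps_ext2_nth_gap)
qed

lemma deformed_tr_nth_gap:
  assumes "gapped n X" "gapped n Y" "gapped n Z"
  shows "fps_nth (deformed_tr G X Y Z) n
    = G 0 (fps_nth X n) (fps_nth Y 0) (fps_nth Z 0)
    + G 0 (fps_nth X 0) (fps_nth Y n) (fps_nth Z 0)
    + G 0 (fps_nth X 0) (fps_nth Y 0) (fps_nth Z n)
    + G n (fps_nth X 0) (fps_nth Y 0) (fps_nth Z 0)"
proof -
  have "fps_nth (deformed_tr G X Y Z) n
      = fps_nth (fps_ext3 (G 0) X Y Z) n + fps_nth (fps_ext3 (G n) X Y Z) 0"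
    using n_pos by (simp add: deformed_tr_def sum_atMost_ends fps_ext3_gap)
  then show ?thesis
    using assms n_pos by (simp add: fps_ext3_nth_0 fps_ext3_nth_gap)
qed

lemmas gap_simps =
  gapped_fps_const gapped_deformed_br gapped_deformed_tr
  deformed_br_nth_0 deformed_tr_nth_0 deformed_br_nth_gap deformed_tr_nth_gap

end

section \<open>Linearising the axioms\<close>

text \<open>
  Skew-symmetric maps are alternating when \<open>2\<close> is invertible in the ground field.
\<close>

lemma (in module) eq_neg_self_imp_zero:
  fixes half :: 'a and v :: 'b
  assumes half: "half + half = 1" and v: "v = - v"
  shows "v = 0"
proof -
  have "v = scale half v + scale half v"
    using half by (metis scale_left_distrib scale_one)
  also have "\<dots> = scale half (v + v)"
    by (simp add: scale_right_distrib)
  also have "v + v = 0"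
    using v by (metis add.right_inverse)
  finally show ?thesis
    by simp
qed

lemma bilinear_map_zero:
  assumes "bilinear_map scale f"
  shows "f x 0 = 0" "f 0 x = 0"
  using assms module_hom.zero unfolding bilinear_map_def by blast+

lemma trilinear_map_zero:
  assumes "trilinear_map scale g"
  shows "g x y 0 = 0" "g x 0 y = 0" "g 0 x y = 0"
  using assms module_hom.zero unfolding trilinear_map_def by blast+

theorem proposition3p4:
  fixes scale :: "'k::{alg_closed_field, field_char_0} \<Rightarrow> 'l::ab_group_add \<Rightarrow> 'l"
    and br :: "'l \<Rightarrow> 'l \<Rightarrow> 'l"
    and tr :: "'l \<Rightarrow> 'l \<Rightarrow> 'l \<Rightarrow> 'l"
    and F :: "nat \<Rightarrow> 'l \<Rightarrow> 'l \<Rightarrow> 'l"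
    and G :: "nat \<Rightarrow> 'l \<Rightarrow> 'l \<Rightarrow> 'l \<Rightarrow> 'l"
    and n :: nat
  assumes "lie_yamaguti_algebra scale br tr"
    and "formal_deformation scale br tr F G"
    and "n \<ge> 1"
    and "has_infinitesimal n F G"
  shows "(F n, G n) \<in> cocycles23 scale br tr"
proof -
  interpret L: lie_yamaguti_algebra scale br tr
    by fact
  interpret D: lie_yamaguti_algebra "fps_scale scale" "deformed_br F" "deformed_tr G"
    using assms(2) by (simp add: formal_deformation_def)
  have F: "bilinear_map scale (F i)" and G: "trilinear_map scale (G i)" for i
    using assms(2) by (auto simp: formal_deformation_def)
  have F0: "F 0 = br" and G0: "G 0 = tr"
    using assms(2) by (auto simp: formal_deformation_def)
  interpret gapped_operations n F G
    using assms(3,4) bilinear_map_zero[OF F] trilinear_map_zero[OF G]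
    by unfold_locales (auto simp: has_infinitesimal_def)
  note zeros [simp] = F_zero[of 0, unfolded F0] G_zero[of 0, unfolded G0]
  note coeff = gap_simps F0 G0
  let ?c = "fps_const :: 'l \<Rightarrow> 'l fps"

  have skew_F: "F n x y = - F n y x" for x y
    using arg_cong[OF D.LY1[of "?c x" "?c y"], of "\<lambda>X. fps_nth X n"] n_pos
    by (simp add: coeff)
  have skew_G: "G n x y z = - G n y x z" for x y z
    using arg_cong[OF D.LY2[of "?c x" "?c y" "?c z"], of "\<lambda>X. fps_nth X n"] n_pos
    by (simp add: coeff)
  have half: "1 / 2 + 1 / 2 = (1 :: 'k)"
    by simp
  have cochain: "(F n, G n) \<in> cochains23 scale"
    using F G L.eq_neg_self_imp_zero[OF half skew_F] L.eq_neg_self_imp_zero[OF half skew_G]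
    by (simp add: cochains23_def)

  have LY3_n: "br (F n a b) c + F n (br a b) c + G n a b c
      + (br (F n b c) a + F n (br b c) a + G n b c a)
      + (br (F n c a) b + F n (br c a) b + G n c a b) = 0" for a b c
    using arg_cong[OF D.LY3[of "?c a" "?c b" "?c c"], of "\<lambda>X. fps_nth X n"] n_pos
    by (simp add: coeff cyclic_sum_def)
  have star_I: "delta_star_I br tr (F n, G n) a b c = 0" for a b c
    using LY3_n[of a b c] L.LY1[of "F n a b" c] L.LY1[of "F n b c" a] L.LY1[of "F n c a" b]
    by (simp add: delta_star_I_def algebra_simps)

  have LY4_n: "tr (F n a b) c d + G n (br a b) c d
      + (tr (F n b c) a d + G n (br b c) a d)
      + (tr (F n c a) b d + G n (br c a) b d) = 0" for a b c d
    using arg_cong[OF D.LY4[of "?c d" "?c a" "?c b" "?c c"], of "\<lambda>X. fps_nth X n"] n_pos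
    by (simp add: coeff cyclic_sum_def)
  have star_II: "delta_star_II br tr (F n, G n) a b c d = 0" for a b c d
    using LY4_n[of a b c d] by (simp add: delta_star_II_def algebra_simps)

  have LY5_n: "tr a b (F n c d) + G n a b (br c d)
      = br (G n a b c) d + F n (tr a b c) d + (br c (G n a b d) + F n c (tr a b d))"
    for a b c d
    using arg_cong[OF D.LY5[of "?c a" "?c b" "?c c" "?c d"], of "\<lambda>X. fps_nth X n"] n_pos
    by (simp add: coeff)
  have I: "delta_I br tr (F n, G n) a b c d = 0" for a b c d
    using LY5_n[of a b c d] L.LY1[of "G n a b c" d]
    by (simp add: delta_I_def algebra_simps)

  have LY6_n: "tr a b (G n c d e) + G n a b (tr c d e)
      = tr (G n a b c) d e + G n (tr a b c) d e
      + (tr c (G n a b d) e + G n c (tr a b d) e)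
      + (tr c d (G n a b e) + G n c d (tr a b e))" for a b c d e
    using arg_cong[OF D.LY6[of "?c a" "?c b" "?c c" "?c d" "?c e"], of "\<lambda>X. fps_nth X n"] n_pos
    by (simp add: coeff)
  have II: "delta_II br tr (F n, G n) a b c d e = 0" for a b c d e
    using LY6_n[of a b c d e] L.LY2[of c "G n a b d" e]
    by (simp add: delta_II_def algebra_simps)

  show ?thesis
    using cochain star_I star_II I II by (simp add: cocycles23_def fun_eq_iff)
qed

end
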